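(* Consider a $\pi$-MOMDP with visible state space $\mathcal{S}_v$, hidden state space $\mathcal{S}_h$, action set $\mathcal{A}$ and hidden-observation set $\mathcal{O}_h$, and let $B_h^\pi$ be the set of possibility distributions over $\mathcal{S}_h$. Identify $(s_v,\beta_h)\in\mathcal{S}_v\times B_h^\pi$ with the belief $\beta$ over $\mathcal{S}_v\times\mathcal{S}_h$ given by $\beta(s_v,s_h)=\beta_h(s_h)$ and $\beta(\overline{s}_v,s_h)=0_{\mathcal{L}}$ for $\overline{s}_v\neq s_v$, and write $u_i^*(s_v,\beta_h)=u_i^*(\beta)$, where $u_i^*$ are the belief-space value functions defined in the context. Then, for every horizon $p\ge 1$, every $i\in\{1,\dots,p\}$ and every $(s_v,\beta_h)\in\mathcal{S}_v\times B_h^\pi$, $$u_i^*(s_v,\beta_h)=\max_{a\in\mathcal{A}}\max_{s'_v\in\mathcal{S}_v}\max_{o'_h\in\mathcal{O}_h}\min\left\{\beta^a(s'_v,o'_h),\,u_{i-1}^*\big(s'_v,\beta_h^{a,s'_v,o'_h}\big)\right\},$$ with the initialization $u_0^*(s_v,\beta_h)=\mu(s_v,\beta_h)$, where $$\mu(s_v,\beta_h)=\min_{s_h\in\mathcal{S}_h}\max\{\mu(s_v,s_h),n(\beta_h(s_h))\},$$ $$\beta^a(s'_v,o'_h)=\max_{s'_h\in\mathcal{S}_h}\min\{\pi(o'_h\mid s'_v,s'_h,a),\beta^a(s'_v,s'_h)\},$$ and $$\beta_h^{a,s'_v,o'_h}(s'_h)=\begin{cases}1_{\mathcal{L}}&\text{if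 }\min\{\pi(o'_h\mid s'_v,s'_h,a),\beta^a(s'_v,s'_h)\}=\beta^a(s'_v,o'_h)>0_{\mathcal{L}},\\ \min\{\pi(o'_h\mid s'_v,s'_h,a),\beta^a(s'_v,s'_h)\}&\text{otherwise.}\end{cases}$$ (Here $\beta^a(s'_v,s'_h)=\max_{s_h\in\mathcal{S}_h}\min\{\pi((s'_v,s'_h)\mid(s_v,s_h),a),\beta_h(s_h)\}$.)
   Context: $\mathcal{L}$ is a finite totally ordered set with least element $0_{\mathcal{L}}$ and greatest element $1_{\mathcal{L}}\neq 0_{\mathcal{L}}$, and $n:\mathcal{L}\to\mathcal{L}$ is the order-reversing bijection. A possibility distribution over a finite set $X$ is a function $X\to\mathcal{L}$ with maximum $1_{\mathcal{L}}$. A $\pi$-MOMDP has a finite state space $\mathcal{S}=\mathcal{S}_v\times\mathcal{S}_h$, a finite action set $\mathcal{A}$, transition possibilities $\pi(s'\mid s,a)\in\mathcal{L}$ (a possibility distribution in $s'\in\mathcal{S}$), a finite set $\mathcal{O}_h$ with observation possibilities $\pi(o'_h\mid s',a)=\pi(o'_h\mid s'_v,s'_h,a)\in\mathcal{L}$ (a possibility distribution in $o'_h$ for each $s'=(s'_v,s'_h)\in\mathcal{S}$, $a\in\mathcal{A}$), and a preference function $\mu:\mathcal{S}\to\mathcal{L}$. Its full observation set is $\mathcal{O}=\mathcal{O}_v\times\mathcal{O}_h$ with $\mathcal{O}_v=\mathcal{S}_v$, and $\pi((o'_v,o'_h)\mid s',a)=\pi(o'_h\mid s',a)$ if $o'_v=s'_v$,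 and $0_{\mathcal{L}}$ otherwise. Let $B^\pi$ be the set of possibility distributions over $\mathcal{S}$ (beliefs). For $\beta\in B^\pi$, $a\in\mathcal{A}$, $o'\in\mathcal{O}$: $\beta^a(s')=\max_{s\in\mathcal{S}}\min\{\pi(s'\mid s,a),\beta(s)\}$; $\pi(s',o'\mid\beta,a)=\min\{\pi(o'\mid s',a),\beta^a(s')\}$; $\beta^a(o')=\max_{s'\in\mathcal{S}}\pi(s',o'\mid\beta,a)$; and the updated belief is $\beta^{a,o'}(s')=1_{\mathcal{L}}$ if $\beta^a(o')=\pi(s',o'\mid\beta,a)>0_{\mathcal{L}}$, and $\beta^{a,o'}(s')=\pi(s',o'\mid\beta,a)$ otherwise. The preference over beliefs is $\mu(\beta)=\min_{s\in\mathcal{S}}\max\{\mu(s),n(\beta(s))\}$. The value functions on $B^\pi$ are defined by $u_0^*(\beta)=\mu(\beta)$ and, for $i\ge 1$, $$u_i^*(\beta)=\max_{a\in\mathcal{A}}\max_{o'\in\mathcal{O}}\min\{\beta^a(o'),u_{i-1}^*(\beta^{a,o'})\}.$$ Convention: a term $\min\{\beta^a(o'),\cdot\}$ (resp. $\min\{\beta^a(s'_v,o'_h),\cdot\}$) with first entry $0_{\mathcal{L}}$ is $0_{\mathcal{L}}$, whatever the second entry (the updated belief is then not a normalized distribution). *)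

theory Defs
  imports Main
begin

text \<open>
  The qualitative scale is a finite linearly ordered type \<open>'l\<close> with least element
  \<^term>\<open>bot\<close> and greatest element \<^term>\<open>top\<close>; the state, action and observation sets are
  finite types.
\<close>

definition order_reversing_bij :: "('l::linorder \<Rightarrow> 'l) \<Rightarrow> bool" where
  "order_reversing_bij n \<longleftrightarrow> bij n \<and> antimono n"

definition possibility_distribution ::
  "('x::finite \<Rightarrow> 'l::{finite, linorder, order_bot, order_top}) \<Rightarrow> bool" where
  "possibility_distribution f \<longleftrightarrow> (MAX x. f x) = top"

text \<open>
  Conditioning variables come first: \<open>trans M s a s'\<close> is $\pi(s' \mid s,a)$ and
  \<open>obs_h M s' a o\<^sub>h\<close> is $\pi(o_h \mid s',a)$.
\<close>

record ('v, 'h, 'a, 'o, 'l) momdp =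
  trans :: "'v \<times> 'h \<Rightarrow> 'a \<Rightarrow> 'v \<times> 'h \<Rightarrow> 'l"
  obs_h :: "'v \<times> 'h \<Rightarrow> 'a \<Rightarrow> 'o \<Rightarrow> 'l"
  pref :: "'v \<times> 'h \<Rightarrow> 'l"

definition pi_momdp ::
  "('v::finite, 'h::finite, 'a::finite, 'o::finite,
    'l::{finite, linorder, order_bot, order_top}) momdp \<Rightarrow> bool" where
  "pi_momdp M \<longleftrightarrow>
     (\<forall>s a. possibility_distribution (trans M s a)) \<and>
     (\<forall>s' a. possibility_distribution (obs_h M s' a))"


subsection \<open>Beliefs over the full state space\<close>

definition obs ::
  "('v::finite, 'h::finite, 'a::finite, 'o::finite,
    'l::{finite, linorder, order_bot, order_top}) momdp \<Rightarrow>
   'v \<times> 'h \<Rightarrow> 'a \<Rightarrow> 'v \<times> 'o \<Rightarrow> 'l" where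
  "obs M s' a o' = (if fst o' = fst s' then obs_h M s' a (snd o') else bot)"

text \<open>The predicted belief $\beta^a(s')$.\<close>

definition belief_pred ::
  "('v::finite, 'h::finite, 'a::finite, 'o::finite,
    'l::{finite, linorder, order_bot, order_top}) momdp \<Rightarrow>
   ('v \<times> 'h \<Rightarrow> 'l) \<Rightarrow> 'a \<Rightarrow> 'v \<times> 'h \<Rightarrow> 'l" where
  "belief_pred M \<beta> a s' = (MAX s. min (trans M s a s') (\<beta> s))"

text \<open>The joint possibility $\pi(s',o' \mid \beta,a)$.\<close>

definition belief_joint ::
  "('v::finite, 'h::finite, 'a::finite, 'o::finite,
    'l::{finite, linorder, order_bot, order_top}) momdp \<Rightarrow>
   ('v \<times> 'h \<Rightarrow> 'l) \<Rightarrow> 'a \<Rightarrow> 'v \<times> 'h \<Rightarrow> 'v \<times> 'o \<Rightarrow> 'l" where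
  "belief_joint M \<beta> a s' o' = min (obs M s' a o') (belief_pred M \<beta> a s')"

text \<open>The observation possibility $\beta^a(o')$.\<close>

definition belief_obs ::
  "('v::finite, 'h::finite, 'a::finite, 'o::finite,
    'l::{finite, linorder, order_bot, order_top}) momdp \<Rightarrow>
   ('v \<times> 'h \<Rightarrow> 'l) \<Rightarrow> 'a \<Rightarrow> 'v \<times> 'o \<Rightarrow> 'l" where
  "belief_obs M \<beta> a o' = (MAX s'. belief_joint M \<beta> a s' o')"

text \<open>The updated belief $\beta^{a,o'}$.\<close>

definition belief_update ::
  "('v::finite, 'h::finite, 'a::finite, 'o::finite,
    'l::{finite, linorder, order_bot, order_top}) momdp \<Rightarrow>
   ('v \<times> 'h \<Rightarrow> 'l) \<Rightarrow> 'a \<Rightarrow> 'v \<times> 'o \<Rightarrow> 'v \<times> 'h \<Rightarrow> 'l" where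
  "belief_update M \<beta> a o' s' =
     (if belief_obs M \<beta> a o' = belief_joint M \<beta> a s' o' \<and> belief_joint M \<beta> a s' o' > bot
      then top else belief_joint M \<beta> a s' o')"

definition belief_pref ::
  "('l \<Rightarrow> 'l) \<Rightarrow>
   ('v::finite, 'h::finite, 'a::finite, 'o::finite,
    'l::{finite, linorder, order_bot, order_top}) momdp \<Rightarrow>
   ('v \<times> 'h \<Rightarrow> 'l) \<Rightarrow> 'l" where
  "belief_pref n M \<beta> = (MIN s. max (pref M s) (n (\<beta> s)))"

text \<open>
  The value functions are total on \<^typ>\<open>'v \<times> 'h \<Rightarrow> 'l\<close>.  Their values at functions that are not
  possibility distributions are irrelevant: the updated belief fails to be normalized only if
  \<open>belief_obs M \<beta> a o' = bot\<close>, and then the corresponding \<^term>\<open>min\<close> is \<^term>\<open>bot\<close>.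
\<close>

primrec u_star ::
  "('l \<Rightarrow> 'l) \<Rightarrow>
   ('v::finite, 'h::finite, 'a::finite, 'o::finite,
    'l::{finite, linorder, order_bot, order_top}) momdp \<Rightarrow>
   nat \<Rightarrow> ('v \<times> 'h \<Rightarrow> 'l) \<Rightarrow> 'l" where
  "u_star n M 0 \<beta> = belief_pref n M \<beta>"
| "u_star n M (Suc i) \<beta> =
     (MAX a. MAX o'. min (belief_obs M \<beta> a o') (u_star n M i (belief_update M \<beta> a o')))"


subsection \<open>Visible states with beliefs over the hidden states\<close>

definition embed_belief ::
  "'v \<Rightarrow> ('h \<Rightarrow> 'l::order_bot) \<Rightarrow> 'v \<times> 'h \<Rightarrow> 'l" where
  "embed_belief s\<^sub>v \<beta>\<^sub>h s = (if fst s = s\<^sub>v then \<beta>\<^sub>h (snd s) else bot)"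

definition u_star_vh ::
  "('l \<Rightarrow> 'l) \<Rightarrow>
   ('v::finite, 'h::finite, 'a::finite, 'o::finite,
    'l::{finite, linorder, order_bot, order_top}) momdp \<Rightarrow>
   nat \<Rightarrow> 'v \<Rightarrow> ('h \<Rightarrow> 'l) \<Rightarrow> 'l" where
  "u_star_vh n M i s\<^sub>v \<beta>\<^sub>h = u_star n M i (embed_belief s\<^sub>v \<beta>\<^sub>h)"

definition pref_vh ::
  "('l \<Rightarrow> 'l) \<Rightarrow>
   ('v::finite, 'h::finite, 'a::finite, 'o::finite,
    'l::{finite, linorder, order_bot, order_top}) momdp \<Rightarrow>
   'v \<Rightarrow> ('h \<Rightarrow> 'l) \<Rightarrow> 'l" where
  "pref_vh n M s\<^sub>v \<beta>\<^sub>h = (MIN s\<^sub>h. max (pref M (s\<^sub>v, s\<^sub>h)) (n (\<beta>\<^sub>h s\<^sub>h)))"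

text \<open>
  The prediction $\beta^a(s'_v,s'_h)$, computed from $(s_v,\beta_h)$ by a maximum over hidden
  states only.
\<close>

definition pred_vh ::
  "('v::finite, 'h::finite, 'a::finite, 'o::finite,
    'l::{finite, linorder, order_bot, order_top}) momdp \<Rightarrow>
   'v \<Rightarrow> ('h \<Rightarrow> 'l) \<Rightarrow> 'a \<Rightarrow> 'v \<Rightarrow> 'h \<Rightarrow> 'l" where
  "pred_vh M s\<^sub>v \<beta>\<^sub>h a s\<^sub>v' s\<^sub>h' = (MAX s\<^sub>h. min (trans M (s\<^sub>v, s\<^sub>h) a (s\<^sub>v', s\<^sub>h')) (\<beta>\<^sub>h s\<^sub>h))"

text \<open>The observation possibility $\beta^a(s'_v,o'_h)$.\<close>

definition obs_vh ::
  "('v::finite, 'h::finite, 'a::finite, 'o::finite,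
    'l::{finite, linorder, order_bot, order_top}) momdp \<Rightarrow>
   'v \<Rightarrow> ('h \<Rightarrow> 'l) \<Rightarrow> 'a \<Rightarrow> 'v \<Rightarrow> 'o \<Rightarrow> 'l" where
  "obs_vh M s\<^sub>v \<beta>\<^sub>h a s\<^sub>v' o\<^sub>h' =
     (MAX s\<^sub>h'. min (obs_h M (s\<^sub>v', s\<^sub>h') a o\<^sub>h') (pred_vh M s\<^sub>v \<beta>\<^sub>h a s\<^sub>v' s\<^sub>h'))"

text \<open>The updated hidden belief $\beta_h^{a,s'_v,o'_h}$.\<close>

definition update_h ::
  "('v::finite, 'h::finite, 'a::finite, 'o::finite,
    'l::{finite, linorder, order_bot, order_top}) momdp \<Rightarrow>
   'v \<Rightarrow> ('h \<Rightarrow> 'l) \<Rightarrow> 'a \<Rightarrow> 'v \<Rightarrow> 'o \<Rightarrow> 'h \<Rightarrow> 'l" where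
  "update_h M s\<^sub>v \<beta>\<^sub>h a s\<^sub>v' o\<^sub>h' s\<^sub>h' =
     (if min (obs_h M (s\<^sub>v', s\<^sub>h') a o\<^sub>h') (pred_vh M s\<^sub>v \<beta>\<^sub>h a s\<^sub>v' s\<^sub>h') = obs_vh M s\<^sub>v \<beta>\<^sub>h a s\<^sub>v' o\<^sub>h' \<and>
         obs_vh M s\<^sub>v \<beta>\<^sub>h a s\<^sub>v' o\<^sub>h' > bot
      then top
      else min (obs_h M (s\<^sub>v', s\<^sub>h') a o\<^sub>h') (pred_vh M s\<^sub>v \<beta>\<^sub>h a s\<^sub>v' s\<^sub>h'))"

end

theory Submission
  imports Defs
begin

text \<open>
  The belief identified with \<open>(s\<^sub>v, \<beta>\<^sub>h)\<close> vanishes off the fiber over \<open>s\<^sub>v\<close>, and an observation whose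
  visible component is \<open>s\<^sub>v'\<close> is impossible off the fiber over \<open>s\<^sub>v'\<close>.  Hence every maximum over full
  states reduces to one over hidden states, and the updated belief is again concentrated on a
  single fiber.  The recursion for \<^const>\<open>u_star\<close> therefore stays within such beliefs.
\<close>

lemma Max_range_prod:
  fixes f :: "'x::finite \<times> 'y::finite \<Rightarrow> 'l::linorder"
  shows "(MAX p. f p) = (MAX x. MAX y. f (x, y))"
proof (rule order.antisym)
  have "f (x, y) \<le> (MAX x. MAX y. f (x, y))" for x y
    by (auto simp: Max_ge_iff)
  then show "(MAX p. f p) \<le> (MAX x. MAX y. f (x, y))" by simp
qed simp

text \<open>Entries equal to \<open>bot\<close> are neutral for a maximum, so only the fiber over
  \<open>x\<close> contributes; it is nonempty because \<open>'y\<close> is a nonempty type.\<close>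

lemma Max_range_fiber:
  fixes f :: "'x::finite \<times> 'y::finite \<Rightarrow> 'l::{linorder, order_bot}"
  assumes "\<And>s. fst s \<noteq> x \<Longrightarrow> f s = bot"
  shows "(MAX s. f s) = (MAX y. f (x, y))"
proof (rule order.antisym)
  have "f (x', y) \<le> (MAX y. f (x, y))" for x' y
    using assms [of "(x', y)"] by (cases "x' = x") auto
  then show "(MAX s. f s) \<le> (MAX y. f (x, y))" by simp
qed simp

lemma Min_range_fiber:
  fixes f :: "'x::finite \<times> 'y::finite \<Rightarrow> 'l::{linorder, order_top}"
  assumes "\<And>s. fst s \<noteq> x \<Longrightarrow> f s = top"
  shows "(MIN s. f s) = (MIN y. f (x, y))"
proof (rule order.antisym)
  have "(MIN y. f (x, y)) \<le> f (x', y)" for x' y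
    using assms [of "(x', y)"] by (cases "x' = x") auto
  then show "(MIN y. f (x, y)) \<le> (MIN s. f s)" by simp
qed simp

text \<open>Surjectivity gives a preimage of \<open>top\<close>, and \<open>bot\<close> lies below
  it. This makes the states of belief \<open>bot\<close> neutral in the minimum that defines
  \<open>belief_pref\<close>.\<close>

lemma order_reversing_bij_bot:
  fixes n :: "'l::{linorder, order_bot, order_top} \<Rightarrow> 'l"
  assumes "order_reversing_bij n"
  shows "n bot = top"
proof -
  from assms have "surj n" and "antimono n"
    by (auto simp: order_reversing_bij_def bij_is_surj)
  then obtain x where "top = n x" by (auto simp: surj_def)
  also have "\<dots> \<le> n bot" using \<open>antimono n\<close> by (rule antimonoD) simp
  finally show ?thesis by (simp add: top_unique)
qed

lemma belief_pref_embed: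
  assumes "order_reversing_bij n"
  shows "belief_pref n M (embed_belief s\<^sub>v \<beta>\<^sub>h) = pref_vh n M s\<^sub>v \<beta>\<^sub>h"
  unfolding belief_pref_def pref_vh_def
  by (subst Min_range_fiber [where x = s\<^sub>v])
     (simp_all add: embed_belief_def order_reversing_bij_bot [OF assms] max_absorb2)

lemma belief_pred_embed:
  "belief_pred M (embed_belief s\<^sub>v \<beta>\<^sub>h) a (s\<^sub>v', s\<^sub>h') = pred_vh M s\<^sub>v \<beta>\<^sub>h a s\<^sub>v' s\<^sub>h'"
  unfolding belief_pred_def pred_vh_def
  by (subst Max_range_fiber [where x = s\<^sub>v]) (simp_all add: embed_belief_def min_absorb2)

text \<open>The observation reveals the visible state, so its possibility is \<open>bot\<close>
  unless the visible components agree.\<close>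

lemma belief_joint_embed:
  "belief_joint M (embed_belief s\<^sub>v \<beta>\<^sub>h) a (s\<^sub>v', s\<^sub>h') (o\<^sub>v', o\<^sub>h') =
     (if s\<^sub>v' = o\<^sub>v' then min (obs_h M (s\<^sub>v', s\<^sub>h') a o\<^sub>h') (pred_vh M s\<^sub>v \<beta>\<^sub>h a s\<^sub>v' s\<^sub>h') else bot)"
  by (simp add: belief_joint_def obs_def belief_pred_embed min_absorb1)

lemma belief_obs_embed:
  "belief_obs M (embed_belief s\<^sub>v \<beta>\<^sub>h) a (s\<^sub>v', o\<^sub>h') = obs_vh M s\<^sub>v \<beta>\<^sub>h a s\<^sub>v' o\<^sub>h'"
  unfolding belief_obs_def obs_vh_def
  by (subst Max_range_fiber [where x = s\<^sub>v']) (auto simp: belief_joint_embed)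

text \<open>The two updates test positivity of different quantities, the joint possibility and the
  observation possibility, but under the equality in the same condition these coincide. Off the
  fiber the joint is \<open>bot\<close>, hence never raised to \<open>top\<close>.\<close>

lemma belief_update_embed:
  "belief_update M (embed_belief s\<^sub>v \<beta>\<^sub>h) a (s\<^sub>v', o\<^sub>h') =
     embed_belief s\<^sub>v' (update_h M s\<^sub>v \<beta>\<^sub>h a s\<^sub>v' o\<^sub>h')"
proof
  fix s
  show "belief_update M (embed_belief s\<^sub>v \<beta>\<^sub>h) a (s\<^sub>v', o\<^sub>h') s =
      embed_belief s\<^sub>v' (update_h M s\<^sub>v \<beta>\<^sub>h a s\<^sub>v' o\<^sub>h') s"
    by (cases s)
       \<comment> \<open>Removing \<open>min_less_iff_conj\<close> keeps
         \<open>bot < min x y\<close> in one piece, so that the equality can rewrite the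
         minimum.\<close>
       (auto simp: belief_update_def belief_obs_embed belief_joint_embed embed_belief_def
          update_h_def simp del: min_less_iff_conj)
qed

text \<open>One unfolding suffices, without induction on \<open>i\<close>: the updated belief is
  itself embedded, and the maximum over full observations splits into its two components.\<close>

lemma u_star_vh_Suc:
  "u_star_vh n M (Suc i) s\<^sub>v \<beta>\<^sub>h =
     (MAX a. MAX s\<^sub>v'. MAX o\<^sub>h'.
        min (obs_vh M s\<^sub>v \<beta>\<^sub>h a s\<^sub>v' o\<^sub>h') (u_star_vh n M i s\<^sub>v' (update_h M s\<^sub>v \<beta>\<^sub>h a s\<^sub>v' o\<^sub>h')))"
  by (simp add: u_star_vh_def Max_range_prod belief_obs_embed belief_update_embed)

theorem theorem2:
  fixes M :: "('v::finite, 'h::finite, 'a::finite, 'o::finite,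
               'l::{finite, linorder, order_bot, order_top}) momdp"
    and n :: "'l \<Rightarrow> 'l"
  assumes "(bot :: 'l) \<noteq> top"
    and "order_reversing_bij n"
    and "pi_momdp M"
  shows "\<forall>p\<ge>1. \<forall>s\<^sub>v \<beta>\<^sub>h. possibility_distribution \<beta>\<^sub>h \<longrightarrow>
           u_star_vh n M 0 s\<^sub>v \<beta>\<^sub>h = pref_vh n M s\<^sub>v \<beta>\<^sub>h \<and>
           (\<forall>a s\<^sub>v' s\<^sub>h'. belief_pred M (embed_belief s\<^sub>v \<beta>\<^sub>h) a (s\<^sub>v', s\<^sub>h') = pred_vh M s\<^sub>v \<beta>\<^sub>h a s\<^sub>v' s\<^sub>h') \<and>
           (\<forall>i\<in>{1..p}.
              u_star_vh n M i s\<^sub>v \<beta>\<^sub>h =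
                (MAX a. MAX s\<^sub>v'. MAX o\<^sub>h'.
                   min (obs_vh M s\<^sub>v \<beta>\<^sub>h a s\<^sub>v' o\<^sub>h')
                       (u_star_vh n M (i - 1) s\<^sub>v' (update_h M s\<^sub>v \<beta>\<^sub>h a s\<^sub>v' o\<^sub>h'))))"
proof (intro allI impI conjI ballI)
  fix p :: nat and s\<^sub>v and \<beta>\<^sub>h :: "'h \<Rightarrow> 'l"
  show "u_star_vh n M 0 s\<^sub>v \<beta>\<^sub>h = pref_vh n M s\<^sub>v \<beta>\<^sub>h"
    using assms(2) by (simp add: u_star_vh_def belief_pref_embed)
  show "belief_pred M (embed_belief s\<^sub>v \<beta>\<^sub>h) a (s\<^sub>v', s\<^sub>h') = pred_vh M s\<^sub>v \<beta>\<^sub>h a s\<^sub>v' s\<^sub>h'" for a s\<^sub>v' s\<^sub>h'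
    by (rule belief_pred_embed)
  show "u_star_vh n M i s\<^sub>v \<beta>\<^sub>h =
      (MAX a. MAX s\<^sub>v'. MAX o\<^sub>h'.
         min (obs_vh M s\<^sub>v \<beta>\<^sub>h a s\<^sub>v' o\<^sub>h')
             (u_star_vh n M (i - 1) s\<^sub>v' (update_h M s\<^sub>v \<beta>\<^sub>h a s\<^sub>v' o\<^sub>h')))"
    if "i \<in> {1..p}" for i
    \<comment> \<open>Since \<open>i\<close> is at least 1, \<open>Suc (i - 1)\<close> is
      \<open>i\<close>.\<close>
    using that u_star_vh_Suc [of n M "i - 1" s\<^sub>v \<beta>\<^sub>h] by simp
qed

end
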